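(* Let $(\Omega,\mu)$ be a $\sigma$-finite measure space and $p \in [1,\infty)$. Let $T: L^p \to L^p$ be a positive linear operator on the complex-valued space $L^p = L^p(\Omega,\mu)$. Assume that $T$ is power bounded and irreducible and that there exists a measurable set $S \subseteq \Omega$ of non-zero measure such that $\operatorname{supp}(Tf) \supseteq \operatorname{supp}(f)$ for each $0 \le f \in L^p$ that satisfies $\operatorname{supp}(f) \subseteq S$. Then $\sigma_{\mathrm{pnt}}(T) \cap \mathbb{T} \subseteq \{1\}$.
   Context: $\mathbb{T} := \{\lambda \in \mathbb{C} : |\lambda| = 1\}$. $\sigma_{\mathrm{pnt}}(T)$ denotes the point spectrum of $T$, i.e. the set of eigenvalues of $T$. Inequalities between functions in $L^p$ are understood almost everywhere. $T$ is positive if $Tf \ge 0$ whenever $f \ge 0$. $T$ is power bounded if $\sup_{n \in \mathbb{N}_0} \|T^n\| < \infty$, where $\mathbb{N}_0=\{0,1,2,\dots\}$. $T$ is irreducible if for each non-zero $0 \le f \in L^p$ and each non-zero linear functional $g \ge 0$ on $L^p$ there exists an integer $n \ge 0$ such that $\langle g, T^n f\rangle > 0$. For $f \in L^p(\Omega,\mu)$ the support is $\operatorname{supp}(f) := \{\omega \in \Omega : f(\omega) \neq 0\}$, which is defined up to a $\mu$-null set; all inclusions involving supports are understood up to $\mu$-null sets. *)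

theory Defs
  imports "HOL-Analysis.Analysis"
begin

text \<open>
  Elements of the complex space $L^p(M)$ are handled through representatives: members of \<open>Lp M p\<close> are measurable
  functions, equality and order of $L^p$ are equality and order almost everywhere, and operators
  and functionals are required to respect equality almost everywhere (so they are exactly the
  lifts of the maps on equivalence classes). Values outside \<open>Lp M p\<close> are irrelevant.

  The order on complex numbers is the one of \<open>HOL-Library.Complex_Order\<close>: \<open>0 \<le> z\<close> and \<open>0 < z\<close>
  include that \<open>z\<close> is real.
\<close>

definition Lp :: "'a measure \<Rightarrow> real \<Rightarrow> ('a \<Rightarrow> complex) set" where
  "Lp M p = {f \<in> borel_measurable M. integrable M (\<lambda>x. cmod (f x) powr p)}"

definition Lp_norm :: "'a measure \<Rightarrow> real \<Rightarrow> ('a \<Rightarrow> complex) \<Rightarrow> real" where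
  "Lp_norm M p f = (\<integral>x. cmod (f x) powr p \<partial>M) powr (1 / p)"

definition Lp_eq :: "'a measure \<Rightarrow> ('a \<Rightarrow> complex) \<Rightarrow> ('a \<Rightarrow> complex) \<Rightarrow> bool" where
  "Lp_eq M f g \<longleftrightarrow> (AE x in M. f x = g x)"

definition Lp_nonneg :: "'a measure \<Rightarrow> ('a \<Rightarrow> complex) \<Rightarrow> bool" where
  "Lp_nonneg M f \<longleftrightarrow> (AE x in M. 0 \<le> f x)"

definition Lp_linear_operator ::
    "'a measure \<Rightarrow> real \<Rightarrow> (('a \<Rightarrow> complex) \<Rightarrow> ('a \<Rightarrow> complex)) \<Rightarrow> bool" where
  "Lp_linear_operator M p T \<longleftrightarrow>
     (\<forall>f\<in>Lp M p. T f \<in> Lp M p) \<and>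
     (\<forall>f\<in>Lp M p. \<forall>g\<in>Lp M p. Lp_eq M f g \<longrightarrow> Lp_eq M (T f) (T g)) \<and>
     (\<forall>f\<in>Lp M p. \<forall>g\<in>Lp M p. Lp_eq M (T (\<lambda>x. f x + g x)) (\<lambda>x. T f x + T g x)) \<and>
     (\<forall>c. \<forall>f\<in>Lp M p. Lp_eq M (T (\<lambda>x. c * f x)) (\<lambda>x. c * T f x))"

definition Lp_linear_functional ::
    "'a measure \<Rightarrow> real \<Rightarrow> (('a \<Rightarrow> complex) \<Rightarrow> complex) \<Rightarrow> bool" where
  "Lp_linear_functional M p g \<longleftrightarrow>
     (\<forall>f\<in>Lp M p. \<forall>h\<in>Lp M p. Lp_eq M f h \<longrightarrow> g f = g h) \<and>
     (\<forall>f\<in>Lp M p. \<forall>h\<in>Lp M p. g (\<lambda>x. f x + h x) = g f + g h) \<and>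
     (\<forall>c. \<forall>f\<in>Lp M p. g (\<lambda>x. c * f x) = c * g f)"

definition Lp_positive_operator ::
    "'a measure \<Rightarrow> real \<Rightarrow> (('a \<Rightarrow> complex) \<Rightarrow> ('a \<Rightarrow> complex)) \<Rightarrow> bool" where
  "Lp_positive_operator M p T \<longleftrightarrow> (\<forall>f\<in>Lp M p. Lp_nonneg M f \<longrightarrow> Lp_nonneg M (T f))"

definition Lp_positive_functional ::
    "'a measure \<Rightarrow> real \<Rightarrow> (('a \<Rightarrow> complex) \<Rightarrow> complex) \<Rightarrow> bool" where
  "Lp_positive_functional M p g \<longleftrightarrow> (\<forall>f\<in>Lp M p. Lp_nonneg M f \<longrightarrow> 0 \<le> g f)"

text \<open>The operator norm, with value \<open>\<infinity>\<close> for unbounded operators.\<close>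

definition Lp_opnorm ::
    "'a measure \<Rightarrow> real \<Rightarrow> (('a \<Rightarrow> complex) \<Rightarrow> ('a \<Rightarrow> complex)) \<Rightarrow> ennreal" where
  "Lp_opnorm M p T = (SUP f\<in>{f \<in> Lp M p. Lp_norm M p f \<le> 1}. ennreal (Lp_norm M p (T f)))"

definition Lp_power_bounded ::
    "'a measure \<Rightarrow> real \<Rightarrow> (('a \<Rightarrow> complex) \<Rightarrow> ('a \<Rightarrow> complex)) \<Rightarrow> bool" where
  "Lp_power_bounded M p T \<longleftrightarrow> (SUP n::nat. Lp_opnorm M p (T ^^ n)) < \<infinity>"

definition Lp_irreducible ::
    "'a measure \<Rightarrow> real \<Rightarrow> (('a \<Rightarrow> complex) \<Rightarrow> ('a \<Rightarrow> complex)) \<Rightarrow> bool" where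
  "Lp_irreducible M p T \<longleftrightarrow>
     (\<forall>f\<in>Lp M p. Lp_nonneg M f \<and> \<not> Lp_eq M f (\<lambda>x. 0) \<longrightarrow>
       (\<forall>g. Lp_linear_functional M p g \<and> Lp_positive_functional M p g \<and> (\<exists>h\<in>Lp M p. g h \<noteq> 0) \<longrightarrow>
         (\<exists>n::nat. 0 < g ((T ^^ n) f))))"

definition Lp_point_spectrum ::
    "'a measure \<Rightarrow> real \<Rightarrow> (('a \<Rightarrow> complex) \<Rightarrow> ('a \<Rightarrow> complex)) \<Rightarrow> complex set" where
  "Lp_point_spectrum M p T =
     {z. \<exists>f\<in>Lp M p. \<not> Lp_eq M f (\<lambda>x. 0) \<and> Lp_eq M (T f) (\<lambda>x. z * f x)}"

definition supp :: "'a measure \<Rightarrow> ('a \<Rightarrow> complex) \<Rightarrow> 'a set" where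
  "supp M f = {x \<in> space M. f x \<noteq> 0}"

definition AE_subset :: "'a measure \<Rightarrow> 'a set \<Rightarrow> 'a set \<Rightarrow> bool" where
  "AE_subset M A B \<longleftrightarrow> (AE x in M. x \<in> A \<longrightarrow> x \<in> B)"

end

theory Submission
  imports Defs
begin

text \<open>
  Let \<open>T f = \<lambda> f\<close> with \<open>f \<noteq> 0\<close> and \<open>\<bar>\<lambda>\<bar> = 1\<close>, and put \<open>u = \<bar>f\<bar>\<close>.

  The modulus \<open>u\<close> is a strictly positive fixed point of \<open>T\<close>. Positivity gives \<open>u \<le> T u\<close>
  (\<open>eigen_modulus_le\<close>). For a set \<open>A\<close> of finite measure, a generalized limit of the Cesaro means of
  \<open>\<integral>\<^sub>A T\<^sup>k g\<close> defines a positive \<open>T\<close>-invariant functional \<open>\<phi>\<close> (\<open>exists_invariant_functional\<close>);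
  power boundedness makes these means bounded. If \<open>u\<close> does not vanish on \<open>A\<close>, then
  \<open>\<phi> u \<ge> \<integral>\<^sub>A u > 0\<close>, because the powers \<open>T\<^sup>k u\<close> increase. But \<open>\<phi>\<close> vanishes on all \<open>T\<^sup>n (T u - u)\<close> by
  invariance, so irreducibility forces \<open>T u = u\<close> (\<open>subinvariant_imp_invariant\<close>). Irreducibility, now tested
  with the functional \<open>g \<mapsto> \<integral>\<^sub>B g\<close> for \<open>B \<subseteq> {u = 0}\<close>, also yields \<open>u > 0\<close> almost everywhere
  (\<open>invariant_nonzero_AE\<close>).

  Now let \<open>s = f / u\<close> be the phase of \<open>f\<close>. For a constant \<open>v\<close> the function
  \<open>u \<bar>s - v\<bar>\<^sup>2 = (1 + \<bar>v\<bar>\<^sup>2) u - 2 Re (cnj v f)\<close> is a combination of \<open>u\<close> and \<open>f\<close>, whence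
  \<open>T (u \<bar>s - v\<bar>\<^sup>2) = u \<bar>\<lambda> s - v\<bar>\<^sup>2\<close>. The right side is small where \<open>\<lambda> s\<close> is close to \<open>v\<close>, so mass located
  where \<open>s\<close> is far from \<open>v\<close> is not transported there. If \<open>\<lambda> \<noteq> 1\<close> and \<open>B \<subseteq> S\<close> is a set on which \<open>s\<close>
  oscillates little compared to \<open>\<bar>\<lambda> - 1\<bar>\<close>, then \<open>\<lambda> s\<close> on \<open>B\<close> is far from all values of \<open>s\<close> on \<open>B\<close>, and
  therefore \<open>T (u 1\<^sub>B) = 0\<close> on \<open>B\<close> (\<open>localized_modulus_vanishes\<close>). The support condition says that
  \<open>T (u 1\<^sub>B)\<close> vanishes nowhere on \<open>B\<close>, so \<open>B\<close> is a null set. Countably many such sets cover \<open>S\<close> up to a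
  null set, contradicting that \<open>S\<close> has non-zero measure.
\<close>

section \<open>Limits of bounded sequences along a common filter\<close>

text \<open>
  Such a filter serves as a generalized limit that is automatically linear and monotone. It exists by Tychonoff's
  theorem: the evaluations \<open>b \<mapsto> b n\<close> on bounded sequences lie in a product of closed discs, so they have a
  cluster point \<open>\<phi>\<close>, and the filter consists of the indices \<open>n\<close> for which evaluation at \<open>n\<close> is close to \<open>\<phi>\<close>.
\<close>

lemma exists_filter_Bseq_converge:
  obtains H :: "nat filter" where "H \<noteq> bot" "H \<le> sequentially"
    "\<forall>b :: nat \<Rightarrow> complex. Bseq b \<longrightarrow> (\<exists>l. (b \<longlongrightarrow> l) H)"
proof -
  define e :: "nat \<Rightarrow> (nat \<Rightarrow> complex) \<Rightarrow> complex" where "e n b = (if Bseq b then b n else 0)" for n b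
  have "\<exists>r. \<forall>n. e n b \<in> cball 0 r" for b
  proof (cases "Bseq b")
    case True
    then show ?thesis
      by (auto simp: e_def Bseq_def)
  qed (auto simp: e_def intro: exI[of _ 0])
  then obtain r where r: "\<And>b n. e n b \<in> cball 0 (r b)"
    by metis
  define K where "K = (\<Pi>\<^sub>E b\<in>UNIV. cball (0::complex) (r b))"
  have "compactin (product_topology (\<lambda>b::nat \<Rightarrow> complex. euclidean) UNIV) K"
    unfolding K_def by (subst compactin_PiE) simp
  then have "compact K"
    by (simp add: euclidean_product_topology)
  moreover have "filtermap e sequentially \<noteq> bot"
    by (simp add: filtermap_bot_iff)
  moreover have "eventually (\<lambda>x. x \<in> K) (filtermap e sequentially)"
    using r unfolding eventually_filtermap K_def
    by (intro always_eventually allI PiE_I) (auto simp del: mem_cball_0)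
  ultimately obtain \<phi> where \<phi>: "inf (nhds \<phi>) (filtermap e sequentially) \<noteq> bot"
    unfolding compact_filter by blast
  define H where "H = inf sequentially (filtercomap e (nhds \<phi>))"
  have H: "H \<noteq> bot"
  proof
    assume "H = bot"
    then have "eventually (\<lambda>_. False) H"
      by simp
    then obtain P Q where P: "eventually P sequentially" and Q: "eventually Q (nhds \<phi>)"
      and PQ: "\<And>n. P n \<Longrightarrow> Q (e n) \<Longrightarrow> False"
      unfolding H_def eventually_inf eventually_filtercomap by blast
    have "eventually (\<lambda>y. \<not> Q y) (filtermap e sequentially)"
      using P unfolding eventually_filtermap by eventually_elim (use PQ in blast)
    with Q have "eventually (\<lambda>_. False) (inf (nhds \<phi>) (filtermap e sequentially))"
      unfolding eventually_inf by blast
    with \<phi> show False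
      by (simp add: trivial_limit_def)
  qed
  have lim: "filterlim e (nhds \<phi>) H"
    unfolding H_def by (metis filterlim_filtercomap filterlim_inf inf_le2 filterlim_mono order_refl)
  have "(b \<longlongrightarrow> \<phi> b) H" if "Bseq b" for b :: "nat \<Rightarrow> complex"
  proof -
    have "continuous_on UNIV (\<lambda>y::(nat \<Rightarrow> complex) \<Rightarrow> complex. y b)"
      by simp
    then have "((\<lambda>y::(nat \<Rightarrow> complex) \<Rightarrow> complex. y b) \<longlongrightarrow> \<phi> b) (nhds \<phi>)"
      unfolding continuous_on_def by (intro tendsto_at_iff_tendsto_nhds[THEN iffD1]) simp
    then have "((\<lambda>n. e n b) \<longlongrightarrow> \<phi> b) H"
      using lim by (rule filterlim_compose)
    then show ?thesis
      using that by (simp add: e_def)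
  qed
  moreover have "H \<le> sequentially"
    by (simp add: H_def)
  ultimately show thesis
    using that H by blast
qed

section \<open>Density and phases in the complex plane\<close>

lemma dense_complex:
  obtains D :: "complex set" where "countable D" "\<forall>z. \<forall>e>0. \<exists>d\<in>D. cmod (d - z) < e"
proof -
  obtain D :: "complex set" where D: "countable D" "\<And>X. open X \<Longrightarrow> X \<noteq> {} \<Longrightarrow> \<exists>d\<in>D. d \<in> X"
    by (rule countable_dense_setE) blast
  have "\<exists>d\<in>D. cmod (d - z) < e" if "0 < e" for z e
    using D(2)[of "ball z e"] that by (auto simp: dist_norm norm_minus_commute)
  with D(1) show thesis
    using that by blast
qed

text \<open>
  This upgrades an inequality that holds almost everywhere for each single \<open>v \<in> D\<close> to one that holds, off one
  common null set, for every complex \<open>v\<close>, even one that depends on the point.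
\<close>

lemma closed_dense_complex:
  assumes "\<forall>z. \<forall>e>0. \<exists>d\<in>D. cmod (d - z) < e" "closed C" "D \<subseteq> C"
  shows "C = (UNIV :: complex set)"
proof -
  have "z \<in> closure D" for z
    unfolding closure_approachable using assms(1) by (simp add: dist_norm)
  then show ?thesis
    using closure_minimal[OF assms(3,2)] by auto
qed

text \<open>
  The left side is real-linear in \<open>\<bar>z\<bar>\<close> and \<open>z\<close>, so an operator that is known on \<open>\<bar>f\<bar>\<close> and \<open>f\<close> only can be
  applied to it; the right side shows how far the phase of \<open>z\<close> is from \<open>v\<close>.
\<close>

lemma norm_square_sgn:
  "(1 + (cmod v)\<^sup>2) * cmod z - 2 * Re (cnj v * z) = cmod z * (cmod (sgn z - v))\<^sup>2"
proof (cases "z = 0")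
  case False
  have Re: "cmod z * Re (cnj v * sgn z) = Re (cnj v * z)"
    using False by (simp add: sgn_div_norm scaleR_conv_of_real field_simps)
  have square: "(cmod (w - v))\<^sup>2 = (cmod w)\<^sup>2 + (cmod v)\<^sup>2 - 2 * Re (cnj v * w)" for w
    by (simp add: cmod_power2 power2_diff algebra_simps)
  have "cmod (sgn z) = 1"
    using False by (simp add: norm_sgn)
  then show ?thesis
    unfolding square Re[symmetric] by algebra
qed simp

section \<open>The space $L^p$\<close>

lemma Lp_measurable: "f \<in> Lp M p \<Longrightarrow> f \<in> borel_measurable M"
  by (simp add: Lp_def)

lemma Lp_dominated:
  assumes "0 \<le> p" "g \<in> Lp M p" "f \<in> borel_measurable M" "AE x in M. cmod (f x) \<le> cmod (g x)"
  shows "f \<in> Lp M p"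
proof -
  have "integrable M (\<lambda>x. cmod (f x) powr p)"
  proof (rule Bochner_Integration.integrable_bound)
    show "integrable M (\<lambda>x. cmod (g x) powr p)"
      using assms(2) by (simp add: Lp_def)
    show "(\<lambda>x. cmod (f x) powr p) \<in> borel_measurable M"
      using assms(3) by measurable
    show "AE x in M. norm (cmod (f x) powr p) \<le> norm (cmod (g x) powr p)"
      using assms(4) by eventually_elim (simp add: powr_mono2 assms(1))
  qed
  with assms(3) show ?thesis
    by (simp add: Lp_def)
qed

lemma Lp_scale: 
  assumes "f \<in> Lp M p"
  shows "(\<lambda>x. c * f x) \<in> Lp M p"
  using assms by (auto simp: Lp_def norm_mult powr_mult)

lemma Lp_add:
  assumes "0 \<le> p" "f \<in> Lp M p" "g \<in> Lp M p"
  shows "(\<lambda>x. f x + g x) \<in> Lp M p"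
proof -
  have [measurable]: "f \<in> borel_measurable M" "g \<in> borel_measurable M"
    using assms by (simp_all add: Lp_def)
  have "integrable M (\<lambda>x. cmod (f x + g x) powr p)"
  proof (rule Bochner_Integration.integrable_bound)
    show "integrable M (\<lambda>x. 2 powr p * (cmod (f x) powr p + cmod (g x) powr p))"
      using assms(2,3) by (simp add: Lp_def)
    show "AE x in M. norm (cmod (f x + g x) powr p)
        \<le> norm (2 powr p * (cmod (f x) powr p + cmod (g x) powr p))"
    proof (rule AE_I2)
      fix x
      have "cmod (f x + g x) \<le> 2 * max (cmod (f x)) (cmod (g x))"
        using norm_triangle_ineq[of "f x" "g x"] by linarith
      then have "cmod (f x + g x) powr p \<le> (2 * max (cmod (f x)) (cmod (g x))) powr p"
        by (intro powr_mono2) (use assms(1) in auto)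
      also have "\<dots> = 2 powr p * max (cmod (f x)) (cmod (g x)) powr p"
        by (subst powr_mult) auto
      also have "\<dots> \<le> 2 powr p * (cmod (f x) powr p + cmod (g x) powr p)"
        by (intro mult_left_mono) (auto simp: max_def)
      finally show "norm (cmod (f x + g x) powr p)
        \<le> norm (2 powr p * (cmod (f x) powr p + cmod (g x) powr p))"
        by simp
    qed
  qed measurable
  then show ?thesis
    by (simp add: Lp_def)
qed

lemma Lp_lincomb:
  assumes "0 \<le> p" "f \<in> Lp M p" "g \<in> Lp M p"
  shows "(\<lambda>x. a * f x + b * g x) \<in> Lp M p"
  by (intro Lp_add Lp_scale assms)

lemma Lp_cmod:
  assumes "f \<in> Lp M p"
  shows "(\<lambda>x. of_real (cmod (f x))) \<in> Lp M p"
  using assms by (auto simp: Lp_def)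

lemma Lp_indicator:
  assumes "0 \<le> p" "A \<in> sets M" "emeasure M A < \<infinity>"
  shows "indicator A \<in> Lp M p"
proof -
  have "(\<lambda>x. cmod (indicator A x) powr p) = (\<lambda>x. indicator A x)"
    by (auto simp: indicator_def)
  then show ?thesis
    using assms by (auto simp: Lp_def)
qed

text \<open>
  Bounding \<open>\<bar>z\<bar>\<close> by \<open>1 + \<bar>z\<bar>\<^sup>p\<close> takes the place of the Hoelder inequality: integration over a set of finite
  measure need not be estimated sharply, only uniformly on orbits.
\<close>

lemma integrable_Lp_indicator:
  assumes "1 \<le> p" "A \<in> sets M" "emeasure M A < \<infinity>" "f \<in> Lp M p"
  shows "integrable M (\<lambda>x. indicator A x * f x)"
    and "cmod (\<integral>x. indicator A x * f x \<partial>M) \<le> measure M A + (\<integral>x. cmod (f x) powr p \<partial>M)"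
proof -
  have [measurable]: "f \<in> borel_measurable M" "A \<in> sets M"
    using assms by (simp_all add: Lp_def)
  have le: "cmod (indicator A x * f x) \<le> indicator A x + cmod (f x) powr p" for x
  proof (cases "cmod (f x) \<le> 1")
    case False
    then have "cmod (f x) powr 1 \<le> cmod (f x) powr p"
      using assms(1) by (intro powr_mono) auto
    with False show ?thesis
      by (auto simp: indicator_def)
  qed (auto simp: indicator_def add_increasing2)
  have int: "integrable M (\<lambda>x. indicator A x + cmod (f x) powr p)"
    using assms by (auto simp: Lp_def)
  show fin: "integrable M (\<lambda>x. indicator A x * f x)"
    by (rule Bochner_Integration.integrable_bound[OF int]) (use le in \<open>auto intro!: AE_I2\<close>)
  have "cmod (\<integral>x. indicator A x * f x \<partial>M) \<le> (\<integral>x. indicator A x + cmod (f x) powr p \<partial>M)"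
    using integral_norm_bound[of M "\<lambda>x. indicator A x * f x"]
      integral_mono[OF integrable_norm[OF fin] int le] by linarith
  also have "\<dots> = measure M A + (\<integral>x. cmod (f x) powr p \<partial>M)"
    using assms by (subst Bochner_Integration.integral_add) (auto simp: Lp_def)
  finally show "cmod (\<integral>x. indicator A x * f x \<partial>M) \<le> measure M A + (\<integral>x. cmod (f x) powr p \<partial>M)" .
qed

lemma Lp_linear_functional_cong:
  assumes "Lp_linear_functional M p g" "f \<in> Lp M p" "h \<in> Lp M p" "AE x in M. f x = h x"
  shows "g f = g h"
  by (rule assms(1)[unfolded Lp_linear_functional_def Lp_eq_def, THEN conjunct1, rule_format,
        OF assms(2-4)])

lemma Lp_linear_functional_add:
  assumes "Lp_linear_functional M p g" "f \<in> Lp M p" "h \<in> Lp M p"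
  shows "g (\<lambda>x. f x + h x) = g f + g h"
  by (rule assms(1)[unfolded Lp_linear_functional_def, THEN conjunct2, THEN conjunct1, rule_format,
        OF assms(2,3)])

lemma Lp_linear_functional_scale:
  assumes "Lp_linear_functional M p g" "f \<in> Lp M p"
  shows "g (\<lambda>x. c * f x) = c * g f"
  by (rule assms(1)[unfolded Lp_linear_functional_def, THEN conjunct2, THEN conjunct2, rule_format,
        OF assms(2)])

lemma Lp_linear_functional_integral_indicator:
  assumes "1 \<le> p" "A \<in> sets M" "emeasure M A < \<infinity>"
  shows "Lp_linear_functional M p (\<lambda>f. \<integral>x. indicator A x * f x \<partial>M)"
  unfolding Lp_linear_functional_def Lp_eq_def
proof (intro conjI ballI allI impI)
  note int = integrable_Lp_indicator(1)[OF assms]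
  show "(\<integral>x. indicator A x * f x \<partial>M) = (\<integral>x. indicator A x * g x \<partial>M)"
    if "f \<in> Lp M p" "g \<in> Lp M p" "AE x in M. f x = g x" for f g :: "'a \<Rightarrow> complex"
    by (intro integral_cong_AE borel_measurable_integrable int that) (use that(3) in auto)
  show "(\<integral>x. indicator A x * (f x + g x) \<partial>M)
      = (\<integral>x. indicator A x * f x \<partial>M) + (\<integral>x. indicator A x * g x \<partial>M)"
    if "f \<in> Lp M p" "g \<in> Lp M p" for f g :: "'a \<Rightarrow> complex"
    by (simp add: distrib_left int that)
  show "(\<integral>x. indicator A x * (c * f x) \<partial>M) = c * (\<integral>x. indicator A x * f x \<partial>M)"
    for f :: "'a \<Rightarrow> complex" and c
    by (simp add: mult.left_commute)
qed

lemma Lp_positive_functional_integral_indicator: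
  assumes "1 \<le> p" "A \<in> sets M" "emeasure M A < \<infinity>"
  shows "Lp_positive_functional M p (\<lambda>f. \<integral>x. indicator A x * f x \<partial>M)"
  unfolding Lp_positive_functional_def
proof (intro ballI impI)
  fix f assume f: "f \<in> Lp M p" "Lp_nonneg M f"
  then have "AE x in M. 0 \<le> Re (indicator A x * f x)" "AE x in M. Im (indicator A x * f x) = 0"
    by (auto simp: less_eq_complex_def indicator_def Lp_nonneg_def)
  then have "0 \<le> (\<integral>x. Re (indicator A x * f x) \<partial>M)" "(\<integral>x. Im (indicator A x * f x) \<partial>M) = 0"
    by (auto intro: integral_nonneg_AE integral_eq_zero_AE)
  then show "0 \<le> (\<integral>x. indicator A x * f x \<partial>M)"
    using integral_Re[OF integrable_Lp_indicator(1)[OF assms f(1)]]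
      integral_Im[OF integrable_Lp_indicator(1)[OF assms f(1)]]
    by (simp add: less_eq_complex_def)
qed

lemma sigma_finite_AE_I:
  assumes "sigma_finite_measure M"
    and P: "\<And>A. A \<in> sets M \<Longrightarrow> emeasure M A < \<infinity> \<Longrightarrow> AE x in M. x \<in> A \<longrightarrow> P x"
  shows "AE x in M. P x"
proof -
  obtain A :: "nat \<Rightarrow> 'a set" where A: "range A \<subseteq> sets M" "(\<Union>i. A i) = space M"
      "\<And>i. emeasure M (A i) \<noteq> \<infinity>"
    using sigma_finite_measure.sigma_finite[OF assms(1)] by metis
  have "AE x in M. \<forall>i. x \<in> A i \<longrightarrow> P x"
    unfolding AE_all_countable using A by (intro allI P) (auto simp: less_top)
  moreover have "AE x in M. x \<in> space M"
    by simp
  ultimately show ?thesis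
    by eventually_elim (use A(2) in blast)
qed

section \<open>Positive operators and invariant functionals\<close>

locale positive_Lp_operator =
  fixes M :: "'a measure" and p :: real and T :: "('a \<Rightarrow> complex) \<Rightarrow> ('a \<Rightarrow> complex)"
  assumes p: "1 \<le> p"
    and linear: "Lp_linear_operator M p T"
    and positive: "Lp_positive_operator M p T"
begin

lemma p0: "0 \<le> p"
  using p by simp

lemma maps_Lp: "f \<in> Lp M p \<Longrightarrow> T f \<in> Lp M p"
  using linear by (simp add: Lp_linear_operator_def)

lemma cong_AE: "f \<in> Lp M p \<Longrightarrow> g \<in> Lp M p \<Longrightarrow> AE x in M. f x = g x \<Longrightarrow> AE x in M. T f x = T g x"
  using linear by (simp add: Lp_linear_operator_def Lp_eq_def)

lemma scale: "f \<in> Lp M p \<Longrightarrow> AE x in M. T (\<lambda>x. c * f x) x = c * T f x"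
  using linear by (simp add: Lp_linear_operator_def Lp_eq_def)

lemma add: "f \<in> Lp M p \<Longrightarrow> g \<in> Lp M p \<Longrightarrow> AE x in M. T (\<lambda>x. f x + g x) x = T f x + T g x"
  using linear by (simp add: Lp_linear_operator_def Lp_eq_def)

lemma nonneg: "f \<in> Lp M p \<Longrightarrow> AE x in M. 0 \<le> f x \<Longrightarrow> AE x in M. 0 \<le> T f x"
  using positive by (simp add: Lp_positive_operator_def Lp_nonneg_def)

lemma lincomb:
  assumes "f \<in> Lp M p" "g \<in> Lp M p"
  shows "AE x in M. T (\<lambda>x. a * f x + b * g x) x = a * T f x + b * T g x"
  using add[OF Lp_scale[OF assms(1), of a] Lp_scale[OF assms(2), of b]]
    scale[OF assms(1), of a] scale[OF assms(2), of b]
  by eventually_elim simp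

text \<open>A real function is a difference of two non-negative ones, and \<open>T\<close> maps both to real functions.\<close>

lemma real_valued:
  assumes "f \<in> Lp M p" "\<And>x. Im (f x) = 0"
  shows "AE x in M. Im (T f x) = 0"
proof -
  have [measurable]: "f \<in> borel_measurable M"
    using assms by (simp add: Lp_def)
  define f1 f2 where "f1 = (\<lambda>x. complex_of_real (max (Re (f x)) 0))"
    and "f2 = (\<lambda>x. complex_of_real (max (- Re (f x)) 0))"
  have f12: "f1 \<in> Lp M p" "f2 \<in> Lp M p"
    by (rule Lp_dominated[OF p0 assms(1)]; auto simp: f1_def f2_def assms(2) cmod_def)+
  have "AE x in M. T (\<lambda>x. f x + f2 x) x = T f1 x"
    by (rule cong_AE[OF Lp_add[OF p0 assms(1) f12(2)] f12(1)])
      (auto simp: assms complex_eq_iff f1_def f2_def)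
  with add[OF assms(1) f12(2)] nonneg[OF f12(1)] nonneg[OF f12(2)]
  have "AE x in M. T f1 x = T f x + T f2 x \<and> 0 \<le> T f1 x \<and> 0 \<le> T f2 x"
    by (auto simp: f1_def f2_def less_eq_complex_def)
  then show ?thesis
    by eventually_elim (auto simp: less_eq_complex_def)
qed

lemma Re_nonneg:
  assumes "f \<in> Lp M p" "AE x in M. 0 \<le> Re (f x)"
  shows "AE x in M. 0 \<le> Re (T f x)"
proof -
  have [measurable]: "f \<in> borel_measurable M"
    using assms by (simp add: Lp_def)
  have R: "(\<lambda>x. of_real (Re (f x))) \<in> Lp M p" and I: "(\<lambda>x. of_real (Im (f x))) \<in> Lp M p"
    by (rule Lp_dominated[OF p0 assms(1)]; auto intro: AE_I2 abs_Re_le_cmod abs_Im_le_cmod)+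
  have "(\<lambda>x. 1 * complex_of_real (Re (f x)) + \<i> * complex_of_real (Im (f x))) = f"
    by (auto simp: complex_eq_iff)
  with lincomb[OF R I, of 1 \<i>]
  have "AE x in M. T f x = T (\<lambda>x. of_real (Re (f x))) x + \<i> * T (\<lambda>x. of_real (Im (f x))) x"
    by simp
  moreover have "AE x in M. 0 \<le> T (\<lambda>x. of_real (Re (f x))) x"
    using assms(2) by (intro nonneg R) (simp add: less_eq_complex_def)
  moreover have "AE x in M. Im (T (\<lambda>x. of_real (Im (f x))) x) = 0"
    by (intro real_valued I) simp
  ultimately show ?thesis
    by eventually_elim (simp add: less_eq_complex_def)
qed

text \<open>
  Monotonicity in terms of real parts: since \<open>T\<close> commutes with taking real parts, complex multiples of
  an eigenfunction can be compared with real functions directly.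
\<close>

lemma Re_mono:
  assumes "f \<in> Lp M p" "g \<in> Lp M p" "AE x in M. Re (f x) \<le> Re (g x)"
  shows "AE x in M. Re (T f x) \<le> Re (T g x)"
proof -
  have "AE x in M. 0 \<le> Re (T (\<lambda>x. 1 * g x + (-1) * f x) x)"
    using assms(3) by (intro Re_nonneg Lp_lincomb assms p0) auto
  with lincomb[OF assms(2,1), of 1 "-1"] show ?thesis
    by eventually_elim simp
qed

lemma funpow: "positive_Lp_operator M p (T ^^ n)"
proof (induction n)
  case 0
  show ?case
    using p by unfold_locales (auto simp: Lp_linear_operator_def Lp_eq_def Lp_positive_operator_def)
next
  case (Suc n)
  interpret P: positive_Lp_operator M p "T ^^ n"
    by (fact Suc)
  have "AE x in M. T ((T ^^ n) f) x = T ((T ^^ n) g) x"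
    if "f \<in> Lp M p" "g \<in> Lp M p" "AE x in M. f x = g x" for f g
    using that by (intro cong_AE P.cong_AE P.maps_Lp)
  moreover have "AE x in M. T ((T ^^ n) (\<lambda>x. f x + g x)) x = T ((T ^^ n) f) x + T ((T ^^ n) g) x"
    if "f \<in> Lp M p" "g \<in> Lp M p" for f g
    using cong_AE[OF P.maps_Lp[OF Lp_add[OF p0 that]] Lp_add[OF p0 that[THEN P.maps_Lp]] P.add[OF that]]
      add[OF that[THEN P.maps_Lp]]
    by eventually_elim simp
  moreover have "AE x in M. T ((T ^^ n) (\<lambda>x. c * f x)) x = c * T ((T ^^ n) f) x"
    if "f \<in> Lp M p" for c f
    using cong_AE[OF P.maps_Lp[OF Lp_scale[OF that]] Lp_scale[OF P.maps_Lp[OF that]] P.scale[OF that, of c]]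
      scale[OF P.maps_Lp[OF that], of c]
    by eventually_elim simp
  ultimately show ?case
    using p maps_Lp P.maps_Lp nonneg P.nonneg
    by unfold_locales (simp_all add: Lp_linear_operator_def Lp_eq_def Lp_positive_operator_def Lp_nonneg_def)
qed


text \<open>Power boundedness enters the proof only through this bound on single orbits.\<close>

lemma power_bounded_orbit:
  assumes "Lp_power_bounded M p T" "f \<in> Lp M p"
  obtains C where "\<forall>n. (\<integral>x. cmod ((T ^^ n) f x) powr p \<partial>M) \<le> C"
proof -
  obtain K where K: "(SUP n. Lp_opnorm M p (T ^^ n)) = ennreal K" "0 \<le> K"
    using assms(1) by (cases "SUP n. Lp_opnorm M p (T ^^ n)") (simp_all add: Lp_power_bounded_def)
  \<comment> \<open>The operator norm only sees the unit ball, so \<open>f\<close> is scaled into it.\<close>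
  define c where "c = 1 / (1 + Lp_norm M p f)"
  have N: "0 \<le> Lp_norm M p f"
    by (simp add: Lp_norm_def)
  then have c: "0 < c"
    by (simp add: c_def)
  have norm_c: "(\<integral>x. cmod (of_real c * g x) powr p \<partial>M) = c powr p * (\<integral>x. cmod (g x) powr p \<partial>M)" for g :: "'a \<Rightarrow> complex"
    using c by (simp add: norm_mult powr_mult)
  have cf: "(\<lambda>x. of_real c * f x) \<in> Lp M p"
    by (rule Lp_scale[OF assms(2)])
  have "Lp_norm M p (\<lambda>x. of_real c * f x) = c * Lp_norm M p f"
    using c p by (simp add: Lp_norm_def norm_c powr_mult powr_powr)
  also have "\<dots> \<le> 1"
    using N by (simp add: c_def)
  finally have le1: "Lp_norm M p (\<lambda>x. of_real c * f x) \<le> 1" .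
  have "(\<integral>x. cmod ((T ^^ n) f x) powr p \<partial>M) \<le> K powr p / c powr p" for n
  proof -
    interpret P: positive_Lp_operator M p "T ^^ n"
      by (rule funpow)
    let ?J = "\<integral>x. cmod ((T ^^ n) f x) powr p \<partial>M"
    have [measurable]: "(T ^^ n) f \<in> borel_measurable M" "(T ^^ n) (\<lambda>x. of_real c * f x) \<in> borel_measurable M"
      by (intro Lp_measurable[of _ _ p] P.maps_Lp cf assms)+
    have "ennreal (Lp_norm M p ((T ^^ n) (\<lambda>x. of_real c * f x))) \<le> Lp_opnorm M p (T ^^ n)"
      unfolding Lp_opnorm_def by (intro SUP_upper) (use cf le1 in simp)
    also have "\<dots> \<le> ennreal K"
      unfolding K(1)[symmetric] by (intro SUP_upper) simp
    finally have "Lp_norm M p ((T ^^ n) (\<lambda>x. of_real c * f x)) \<le> K"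
      using K(2) by simp
    moreover have "(\<integral>x. cmod ((T ^^ n) (\<lambda>x. of_real c * f x) x) powr p \<partial>M)
        = (\<integral>x. cmod (of_real c * (T ^^ n) f x) powr p \<partial>M)"
      by (intro integral_cong_AE) (use P.scale[OF assms(2), of "of_real c"] in auto)
    ultimately have "(c powr p * ?J) powr (1 / p) \<le> K"
      by (simp add: Lp_norm_def norm_c)
    then have "((c powr p * ?J) powr (1 / p)) powr p \<le> K powr p"
      using p by (intro powr_mono2) auto
    then have "c powr p * ?J \<le> K powr p"
      using p by (simp add: powr_powr)
    then show ?thesis
      using c by (simp add: field_simps)
  qed
  then show thesis
    using that by blast
qed

text \<open>
  The functional is a generalized limit of the Cesaro means of \<open>k \<mapsto> \<integral>\<^sub>A T\<^sup>k f\<close>. Replacing \<open>f\<close> by \<open>T f\<close>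
  changes the means by a telescoping term of order \<open>1 / n\<close>, which makes the limit invariant. The last
  property ensures that the functional is non-zero.
\<close>

lemma exists_invariant_functional:
  assumes "Lp_power_bounded M p T" and A: "A \<in> sets M" "emeasure M A < \<infinity>"
  obtains \<phi> where "Lp_linear_functional M p \<phi>" "Lp_positive_functional M p \<phi>"
    "\<forall>f\<in>Lp M p. \<phi> (T f) = \<phi> f"
    "\<forall>f\<in>Lp M p. \<forall>c. (\<forall>n. c \<le> Re (\<integral>x. indicator A x * (T ^^ n) f x \<partial>M)) \<longrightarrow> c \<le> Re (\<phi> f)"
proof -
  obtain H :: "nat filter" where H: "H \<noteq> bot" "H \<le> sequentially"
    and conv: "\<forall>b :: nat \<Rightarrow> complex. Bseq b \<longrightarrow> (\<exists>l. (b \<longlongrightarrow> l) H)"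
    by (rule exists_filter_Bseq_converge)
  define I :: "('a \<Rightarrow> complex) \<Rightarrow> complex" where "I f = (\<integral>x. indicator A x * f x \<partial>M)" for f
  define m where "m f n = (\<Sum>k<Suc n. I ((T ^^ k) f)) / of_nat (Suc n)" for f n
  define \<phi> where "\<phi> f = Lim H (m f)" for f
  have pow: "(T ^^ k) f \<in> Lp M p" if "f \<in> Lp M p" for k f
    using positive_Lp_operator.maps_Lp[OF funpow that] .
  have lin: "Lp_linear_functional M p I" and pos: "Lp_positive_functional M p I"
    unfolding I_def
    by (rule Lp_linear_functional_integral_indicator[OF p A]
        Lp_positive_functional_integral_indicator[OF p A])+
  note I_cong = Lp_linear_functional_cong[OF lin]
    and I_add = Lp_linear_functional_add[OF lin]
    and I_scale = Lp_linear_functional_scale[OF lin]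
  have bdd: "\<exists>C. \<forall>k. cmod (I ((T ^^ k) f)) \<le> C" if f: "f \<in> Lp M p" for f
  proof -
    obtain C where C: "\<forall>n. (\<integral>x. cmod ((T ^^ n) f x) powr p \<partial>M) \<le> C"
      by (rule power_bounded_orbit[OF assms(1) f])
    have "cmod (I ((T ^^ k) f)) \<le> measure M A + C" for k
      using integrable_Lp_indicator(2)[OF p A pow[OF f], of k] C[rule_format, of k] by (simp add: I_def)
    then show ?thesis by blast
  qed
  have "Bseq (m f)" if f: "f \<in> Lp M p" for f
  proof -
    obtain C where C: "\<And>k. cmod (I ((T ^^ k) f)) \<le> C"
      using bdd[OF f] by blast
    have "cmod (m f n) \<le> C" for n
    proof -
      have "cmod (\<Sum>k<Suc n. I ((T ^^ k) f)) \<le> of_nat (card {..<Suc n}) * C"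
        by (rule sum_norm_bound) (rule C)
      then show ?thesis
        by (simp add: m_def norm_divide field_simps del: sum.lessThan_Suc of_nat_Suc)
    qed
    then show ?thesis
      by (rule BseqI')
  qed
  then have lim: "(m f \<longlongrightarrow> \<phi> f) H" if "f \<in> Lp M p" for f
    using conv[rule_format, of "m f"] tendsto_Lim[of H "m f"] H(1) that by (auto simp: \<phi>_def)
  show thesis
  proof
    show "Lp_linear_functional M p \<phi>"
      unfolding Lp_linear_functional_def
    proof (intro conjI ballI allI impI)
      fix f g assume fg: "f \<in> Lp M p" "g \<in> Lp M p" "Lp_eq M f g"
      have "I ((T ^^ k) f) = I ((T ^^ k) g)" for k
        using positive_Lp_operator.cong_AE[OF funpow fg(1,2)] fg
        by (intro I_cong pow) (auto simp: Lp_eq_def)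
      then have "m f = m g"
        by (simp add: m_def fun_eq_iff)
      then show "\<phi> f = \<phi> g"
        by (simp add: \<phi>_def)
    next
      fix f g assume fg: "f \<in> Lp M p" "g \<in> Lp M p"
      have "I ((T ^^ k) (\<lambda>x. f x + g x)) = I ((T ^^ k) f) + I ((T ^^ k) g)" for k
        using I_cong[OF _ _ positive_Lp_operator.add[OF funpow fg, of k]]
        by (simp add: I_add pow fg Lp_add p0)
      then have "m (\<lambda>x. f x + g x) = (\<lambda>n. m f n + m g n)"
        by (simp add: m_def fun_eq_iff sum.distrib add_divide_distrib del: sum.lessThan_Suc)
      then have "(m (\<lambda>x. f x + g x) \<longlongrightarrow> \<phi> f + \<phi> g) H"
        by (simp add: tendsto_add lim fg)
      then show "\<phi> (\<lambda>x. f x + g x) = \<phi> f + \<phi> g"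
        using tendsto_unique[OF H(1) lim[OF Lp_add[OF p0 fg]]] by blast
    next
      fix c f assume f: "f \<in> Lp M p"
      have "I ((T ^^ k) (\<lambda>x. c * f x)) = c * I ((T ^^ k) f)" for k
        using I_cong[OF _ _ positive_Lp_operator.scale[OF funpow f, of k c]]
        by (simp add: I_scale pow f Lp_scale)
      then have "m (\<lambda>x. c * f x) = (\<lambda>n. c * m f n)"
        by (simp add: m_def fun_eq_iff sum_distrib_left del: sum.lessThan_Suc)
      then have "(m (\<lambda>x. c * f x) \<longlongrightarrow> c * \<phi> f) H"
        by (simp add: tendsto_mult_left lim f)
      then show "\<phi> (\<lambda>x. c * f x) = c * \<phi> f"
        using tendsto_unique[OF H(1) lim[OF Lp_scale[OF f]]] by blast
    qed
    have lower: "c \<le> Re (\<phi> f)" if "f \<in> Lp M p" "\<And>n. c \<le> Re (I ((T ^^ n) f))" for f c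
    proof (rule tendsto_lowerbound[OF tendsto_Re[OF lim[OF that(1)]] _ H(1)])
      have "c \<le> Re (m f n)" for n
      proof -
        have "of_nat (card {..<Suc n}) * c \<le> (\<Sum>k<Suc n. Re (I ((T ^^ k) f)))"
          by (rule sum_bounded_below) (rule that)
        moreover have "Re (m f n) = (\<Sum>k<Suc n. Re (I ((T ^^ k) f))) / of_nat (Suc n)"
          by (simp add: m_def Re_divide_of_nat del: sum.lessThan_Suc of_nat_Suc)
        ultimately show ?thesis
          by (simp add: pos_le_divide_eq mult.commute del: sum.lessThan_Suc of_nat_Suc)
      qed
      then show "\<forall>\<^sub>F n in H. c \<le> Re (m f n)"
        by simp
    qed
    then show "\<forall>f\<in>Lp M p. \<forall>c. (\<forall>n. c \<le> Re (\<integral>x. indicator A x * (T ^^ n) f x \<partial>M)) \<longrightarrow> c \<le> Re (\<phi> f)"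
      by (simp add: I_def)
    show "Lp_positive_functional M p \<phi>"
      unfolding Lp_positive_functional_def
    proof (intro ballI impI)
      fix f assume f: "f \<in> Lp M p" "Lp_nonneg M f"
      have I: "0 \<le> Re (I ((T ^^ k) f)) \<and> Im (I ((T ^^ k) f)) = 0" for k
        using positive_Lp_operator.positive[OF funpow, of k] pos pow[OF f(1)] f
        by (auto simp: Lp_positive_operator_def Lp_positive_functional_def less_eq_complex_def)
      have "Im (m f n) = 0" for n
        using I by (simp add: m_def Im_divide_of_nat del: sum.lessThan_Suc of_nat_Suc)
      then have "Im (\<phi> f) = 0"
        using tendsto_Im[OF lim[OF f(1)]] by (simp add: tendsto_const_iff H(1))
      moreover have "0 \<le> Re (\<phi> f)"
        using I by (intro lower f) auto
      ultimately show "0 \<le> \<phi> f"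
        by (simp add: less_eq_complex_def)
    qed
    show "\<forall>f\<in>Lp M p. \<phi> (T f) = \<phi> f"
    proof
      fix f assume f: "f \<in> Lp M p"
      obtain C where C: "\<And>k. cmod (I ((T ^^ k) f)) \<le> C"
        using bdd[OF f] by blast
      have bound: "cmod (m (T f) n - m f n) \<le> 2 * C * inverse (of_nat (Suc n))" for n
      proof -
        have eq: "m (T f) n - m f n = (I ((T ^^ Suc n) f) - I f) / of_nat (Suc n)"
          unfolding m_def sum.lessThan_Suc_shift[of _ n, of "\<lambda>k. I ((T ^^ k) f)"]
          by (simp add: funpow_swap1 flip: diff_divide_distrib)
        have "cmod (I ((T ^^ Suc n) f) - I f) \<le> 2 * C"
          using norm_triangle_ineq4[of "I ((T ^^ Suc n) f)" "I f"] C[of "Suc n"] C[of 0] by simp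
        then show ?thesis
          unfolding eq norm_divide norm_of_nat unfolding divide_inverse by (rule mult_right_mono) simp
      qed
      have null: "(\<lambda>n. 2 * C * inverse (real (Suc n))) \<longlonglongrightarrow> 0"
        by (rule tendsto_mult_right_zero) (rule LIMSEQ_inverse_real_of_nat)
      have "(\<lambda>n. m (T f) n - m f n) \<longlonglongrightarrow> 0"
        by (rule Lim_null_comparison[OF always_eventually[OF allI[OF bound]] null])
      then have "((\<lambda>n. m (T f) n - m f n) \<longlongrightarrow> 0) H"
        by (rule tendsto_mono[OF H(2)])
      moreover have "((\<lambda>n. m (T f) n - m f n) \<longlongrightarrow> \<phi> (T f) - \<phi> f) H"
        by (intro tendsto_diff lim maps_Lp f)
      ultimately show "\<phi> (T f) = \<phi> f"
        using tendsto_unique[OF H(1)] by fastforce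
    qed
  qed
qed

lemma subinvariant_le_funpow:
  assumes "u \<in> Lp M p" "AE x in M. Re (u x) \<le> Re (T u x)"
  shows "AE x in M. Re (u x) \<le> Re ((T ^^ n) u x)"
proof (induction n)
  case (Suc n)
  have "AE x in M. Re (T u x) \<le> Re (T ((T ^^ n) u) x)"
    using positive_Lp_operator.maps_Lp[OF funpow assms(1)] Suc by (intro Re_mono assms)
  with assms(2) show ?case
    by eventually_elim simp
qed simp

lemma invariant_funpow:
  assumes "u \<in> Lp M p" "AE x in M. T u x = u x"
  shows "AE x in M. (T ^^ n) u x = u x"
proof (induction n)
  case (Suc n)
  have "AE x in M. T ((T ^^ n) u) x = T u x"
    using positive_Lp_operator.maps_Lp[OF funpow assms(1)] Suc by (intro cong_AE assms)
  with assms(2) show ?case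
    by eventually_elim simp
qed simp

text \<open>
  An invariant positive functional vanishes on the orbit of the non-negative function \<open>T u - u\<close>; as it does
  not vanish on \<open>u\<close>, irreducibility leaves only \<open>T u - u = 0\<close>.
\<close>

lemma subinvariant_imp_invariant:
  assumes "sigma_finite_measure M" "Lp_power_bounded M p T" "Lp_irreducible M p T"
    and u: "u \<in> Lp M p" "AE x in M. 0 \<le> u x" "\<not> (AE x in M. u x = 0)"
    and sub: "AE x in M. u x \<le> T u x"
  shows "AE x in M. T u x = u x"
proof -
  obtain A where A: "A \<in> sets M" "emeasure M A < \<infinity>" and uA: "\<not> (AE x in M. x \<in> A \<longrightarrow> u x = 0)"
    using sigma_finite_AE_I[OF assms(1), of "\<lambda>x. u x = 0"] u(3) by blast
  obtain \<phi> where \<phi>: "Lp_linear_functional M p \<phi>" "Lp_positive_functional M p \<phi>"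
      and inv: "\<forall>f\<in>Lp M p. \<phi> (T f) = \<phi> f"
      and lower: "\<forall>f\<in>Lp M p. \<forall>c. (\<forall>n. c \<le> Re (\<integral>x. indicator A x * (T ^^ n) f x \<partial>M)) \<longrightarrow> c \<le> Re (\<phi> f)"
    by (rule exists_invariant_functional[OF assms(2) A])
  have pow: "(T ^^ n) f \<in> Lp M p" if "f \<in> Lp M p" for n f
    using positive_Lp_operator.maps_Lp[OF funpow that] .
  note int = integrable_Lp_indicator(1)[OF p A]
  have intR: "integrable M (\<lambda>x. Re (indicator A x * f x))" if "f \<in> Lp M p" for f
    by (rule integrable_Re[OF int[OF that]])
  define c where "c = (\<integral>x. Re (indicator A x * u x) \<partial>M)"
  have nn: "AE x in M. 0 \<le> Re (indicator A x * u x)"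
    using u(2) by eventually_elim (simp add: less_eq_complex_def indicator_def)
  have "c \<noteq> 0"
  proof
    assume "c = 0"
    then have "AE x in M. Re (indicator A x * u x) = 0"
      unfolding c_def using integral_nonneg_eq_0_iff_AE[OF intR[OF u(1)] nn] by simp
    with u(2) have "AE x in M. x \<in> A \<longrightarrow> u x = 0"
      by eventually_elim (auto simp: less_eq_complex_def complex_eq_iff indicator_def)
    with uA show False ..
  qed
  moreover have "0 \<le> c"
    unfolding c_def by (rule integral_nonneg_AE[OF nn])
  moreover have "c \<le> Re (\<phi> u)"
  proof -
    have "c \<le> Re (\<integral>x. indicator A x * (T ^^ n) u x \<partial>M)" for n
    proof -
      have "AE x in M. Re (u x) \<le> Re ((T ^^ n) u x)"
        by (rule subinvariant_le_funpow[OF u(1)]) (use sub in \<open>simp add: less_eq_complex_def\<close>)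
      then have "AE x in M. Re (indicator A x * u x) \<le> Re (indicator A x * (T ^^ n) u x)"
        by eventually_elim (simp add: indicator_def)
      then have "c \<le> (\<integral>x. Re (indicator A x * (T ^^ n) u x) \<partial>M)"
        unfolding c_def by (intro integral_mono_AE intR pow u)
      then show ?thesis
        using integral_Re[OF int[OF pow[OF u(1)]]] by simp
    qed
    with lower u(1) show ?thesis
      by blast
  qed
  ultimately have nz: "\<phi> u \<noteq> 0"
    by auto
  define w where "w = (\<lambda>x. 1 * T u x + (-1) * u x)"
  have w: "w \<in> Lp M p"
    unfolding w_def by (intro Lp_lincomb p0 maps_Lp u)
  have "\<phi> w = \<phi> (\<lambda>x. 1 * T u x) + \<phi> (\<lambda>x. (-1) * u x)"
    unfolding w_def by (intro Lp_linear_functional_add[OF \<phi>(1)] Lp_scale maps_Lp u)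
  also have "\<dots> = 1 * \<phi> (T u) + (-1) * \<phi> u"
    by (simp only: Lp_linear_functional_scale[OF \<phi>(1)] maps_Lp u(1))
  also have "\<dots> = 0"
    using inv u(1) by simp
  finally have "\<phi> w = 0" .
  moreover have "\<phi> ((T ^^ n) w) = \<phi> w" for n
    by (induction n) (use inv pow[OF w] in auto)
  moreover have "Lp_nonneg M w"
    using sub by (simp add: Lp_nonneg_def w_def)
  ultimately have "Lp_eq M w (\<lambda>x. 0)"
    using assms(3) w \<phi> nz u(1) unfolding Lp_irreducible_def
    by (metis less_irrefl)
  then show ?thesis
    by (simp add: Lp_eq_def w_def)
qed

text \<open>
  The orbit of \<open>u\<close> never reaches the zero set of \<open>u\<close>, so by irreducibility integration over any part of that
  zero set is the zero functional.
\<close>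

lemma invariant_nonzero_AE:
  assumes "sigma_finite_measure M" "Lp_irreducible M p T"
    and u: "u \<in> Lp M p" "AE x in M. 0 \<le> u x" "\<not> (AE x in M. u x = 0)"
    and inv: "AE x in M. T u x = u x"
  shows "AE x in M. u x \<noteq> 0"
proof -
  have [measurable]: "u \<in> borel_measurable M"
    by (rule Lp_measurable[OF u(1)])
  show ?thesis
  proof (rule sigma_finite_AE_I[OF assms(1)])
    fix A assume A: "A \<in> sets M" "emeasure M A < \<infinity>"
    define B where "B = A \<inter> {x \<in> space M. u x = 0}"
    have Bm: "B \<in> sets M"
      unfolding B_def using A(1) by measurable
    have "emeasure M B \<le> emeasure M A"
      by (intro emeasure_mono A) (auto simp: B_def)
    then have Bf: "emeasure M B < \<infinity>"
      using A(2) by (rule order_le_less_trans)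
    define \<psi> where "\<psi> f = (\<integral>x. indicator B x * f x \<partial>M)" for f :: "'a \<Rightarrow> complex"
    have lin: "Lp_linear_functional M p \<psi>" and posf: "Lp_positive_functional M p \<psi>"
      unfolding \<psi>_def
      by (rule Lp_linear_functional_integral_indicator[OF p Bm Bf]
          Lp_positive_functional_integral_indicator[OF p Bm Bf])+
    have zero: "\<psi> ((T ^^ n) u) = 0" for n
    proof -
      have "\<psi> ((T ^^ n) u) = \<psi> u"
        using positive_Lp_operator.maps_Lp[OF funpow u(1)] invariant_funpow[OF u(1) inv]
        by (intro Lp_linear_functional_cong[OF lin] u(1))
      also have "\<psi> u = (\<integral>x. 0 \<partial>M)"
        unfolding \<psi>_def by (rule Bochner_Integration.integral_cong) (auto simp: B_def indicator_def)
      finally show ?thesis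
        by simp
    qed
    have "\<not> (\<exists>h\<in>Lp M p. \<psi> h \<noteq> 0)"
      using assms(2) lin posf zero u unfolding Lp_irreducible_def Lp_nonneg_def Lp_eq_def
      by (metis less_irrefl)
    moreover have "\<psi> (indicator B) = (\<integral>x. complex_of_real (indicator B x) \<partial>M)"
      unfolding \<psi>_def by (rule Bochner_Integration.integral_cong) (auto simp: indicator_def)
    moreover have "(\<integral>x. complex_of_real (indicator B x) \<partial>M) = of_real (measure M B)"
      using Bf Bm by (subst integral_complex_of_real) (simp add: less_top)
    ultimately have "measure M B = 0"
      using Lp_indicator[OF p0 Bm Bf] by fastforce
    then have "emeasure M B = 0"
      using Bf by (simp add: emeasure_eq_ennreal_measure less_top)
    then have "AE x in M. x \<notin> B"
      using Bm by (intro AE_not_in null_setsI)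
    moreover have "AE x in M. x \<in> space M"
      by simp
    ultimately show "AE x in M. x \<in> A \<longrightarrow> u x \<noteq> 0"
      by eventually_elim (auto simp: B_def)
  qed
qed

section \<open>Eigenfunctions for unimodular eigenvalues\<close>

text \<open>
  This is \<open>\<bar>T f\<bar> \<le> T \<bar>f\<bar>\<close>, since \<open>\<bar>T f\<bar> = \<bar>f\<bar>\<close> here. The modulus of a complex number \<open>z\<close> is the supremum of \<open>Re (c z)\<close> over
  \<open>\<bar>c\<bar> = 1\<close>, and each \<open>Re (c f)\<close> is below \<open>\<bar>f\<bar>\<close>; allowing all \<open>c\<close>, with \<open>\<bar>c\<bar>\<close> as a factor on the right, lets
  \<open>c\<close> run through a countable dense subset of the plane instead of the circle.
\<close>

lemma eigen_modulus_le:
  assumes f: "f \<in> Lp M p" "AE x in M. T f x = l * f x" "cmod l = 1"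
  shows "AE x in M. complex_of_real (cmod (f x)) \<le> T (\<lambda>x. of_real (cmod (f x))) x"
proof -
  let ?u = "\<lambda>x. complex_of_real (cmod (f x))"
  have u: "?u \<in> Lp M p"
    by (rule Lp_cmod[OF f(1)])
  obtain D :: "complex set" where D: "countable D" "\<forall>z. \<forall>e>0. \<exists>d\<in>D. cmod (d - z) < e"
    by (rule dense_complex)
  have "AE x in M. Re (c * (l * f x)) \<le> cmod c * Re (T ?u x)" for c
  proof -
    have "AE x in M. Re (T (\<lambda>x. c * f x) x) \<le> Re (T (\<lambda>x. of_real (cmod c) * ?u x) x)"
    proof (intro Re_mono Lp_scale f u AE_I2)
      fix x show "Re (c * f x) \<le> Re (of_real (cmod c) * ?u x)"
        using complex_Re_le_cmod[of "c * f x"] by (simp add: norm_mult)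
    qed
    with scale[OF f(1), of c] scale[OF u, of "of_real (cmod c)"] f(2) show ?thesis
      by eventually_elim simp
  qed
  then have "AE x in M. \<forall>c\<in>D. Re (c * (l * f x)) \<le> cmod c * Re (T ?u x)"
    by (simp add: AE_ball_countable D(1))
  moreover have "AE x in M. 0 \<le> T ?u x"
    by (intro nonneg u) (simp add: less_eq_complex_def)
  ultimately show ?thesis
  proof eventually_elim
    fix x assume D': "\<forall>c\<in>D. Re (c * (l * f x)) \<le> cmod c * Re (T ?u x)" and nn: "0 \<le> T ?u x"
    have "closed {c. Re (c * (l * f x)) \<le> cmod c * Re (T ?u x)}"
      by (intro closed_Collect_le continuous_intros)
    then have "{c. Re (c * (l * f x)) \<le> cmod c * Re (T ?u x)} = UNIV"
      using D' by (intro closed_dense_complex[OF D(2)]) auto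
    then have "Re (cnj (l * f x) * (l * f x)) \<le> cmod (cnj (l * f x)) * Re (T ?u x)"
      by blast
    moreover have "Re (cnj z * z) = cmod z * cmod z" for z
      by (simp add: cmod_power2 flip: power2_eq_square)
    ultimately have "cmod (f x) * cmod (f x) \<le> cmod (f x) * Re (T ?u x)"
      by (simp only: complex_mod_cnj norm_mult f(3) mult_1)
    then have "cmod (f x) \<le> Re (T ?u x)"
      using nn by (cases "f x = 0") (auto simp: less_eq_complex_def)
    with nn show "?u x \<le> T ?u x"
      by (simp add: less_eq_complex_def)
  qed
qed

text \<open>
  On \<open>B\<close> the function \<open>\<delta> u\<close> is below \<open>u \<bar>s - v\<bar>\<^sup>2\<close>, where \<open>u = \<bar>f\<bar>\<close> and \<open>s = sgn f\<close>, and \<open>T\<close> maps the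
  latter to \<open>u \<bar>l s - v\<bar>\<^sup>2\<close>.
\<close>

lemma localized_modulus_le:
  assumes f: "f \<in> Lp M p" "AE x in M. T f x = l * f x" "cmod l = 1"
    and inv: "AE x in M. T (\<lambda>x. of_real (cmod (f x))) x = of_real (cmod (f x))"
    and B: "B \<in> sets M" "\<And>y. y \<in> B \<Longrightarrow> \<delta> \<le> (cmod (sgn (f y) - v))\<^sup>2"
  shows "AE x in M. \<delta> * Re (T (\<lambda>x. indicator B x * of_real (cmod (f x))) x)
           \<le> cmod (f x) * (cmod (l * sgn (f x) - v))\<^sup>2"
proof -
  let ?u = "\<lambda>x. complex_of_real (cmod (f x))"
  let ?b = "\<lambda>x. indicator B x * ?u x"
  let ?a = "1 + (cmod v)\<^sup>2"
  have u: "?u \<in> Lp M p"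
    by (rule Lp_cmod[OF f(1)])
  have b: "?b \<in> Lp M p"
    by (rule Lp_dominated[OF p0 u]) (use B(1) Lp_measurable[OF u] in \<open>auto simp: indicator_def\<close>)
  have "AE x in M. Re (T (\<lambda>x. of_real \<delta> * ?b x) x) \<le> Re (T (\<lambda>x. of_real ?a * ?u x + (-2 * cnj v) * f x) x)"
  proof (intro Re_mono Lp_scale b Lp_lincomb p0 u f AE_I2)
    fix x
    have "Re (of_real \<delta> * ?b x) \<le> cmod (f x) * (cmod (sgn (f x) - v))\<^sup>2"
      using B(2)[of x] by (auto simp: indicator_def mult.commute[of \<delta>] intro: mult_left_mono)
    also have "\<dots> = Re (of_real ?a * ?u x + (-2 * cnj v) * f x)"
      unfolding norm_square_sgn[symmetric] by (simp add: algebra_simps)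
    finally show "Re (of_real \<delta> * ?b x) \<le> Re (of_real ?a * ?u x + (-2 * cnj v) * f x)" .
  qed
  with scale[OF b, of "of_real \<delta>"] lincomb[OF u f(1), of "of_real ?a" "-2 * cnj v"] f(2) inv
  show ?thesis
  proof eventually_elim
    case (elim x)
    have "\<delta> * Re (T ?b x) \<le> Re (of_real ?a * ?u x + (-2 * cnj v) * (l * f x))"
      using elim by simp
    also have "\<dots> = ?a * cmod (l * f x) - 2 * Re (cnj v * (l * f x))"
      by (simp add: norm_mult f(3) algebra_simps)
    also have "\<dots> = cmod (f x) * (cmod (l * sgn (f x) - v))\<^sup>2"
      unfolding norm_square_sgn using f(3) by (simp add: norm_mult sgn_mult) (simp add: sgn_div_norm)
    finally show ?case .
  qed
qed

text \<open>
  Let \<open>s = sgn f\<close>. At a point \<open>x \<in> B\<close> the bound of the previous lemma is used with \<open>v \<rightarrow> l s(x)\<close>. Its right side then tends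
  to \<open>0\<close>, while the constant on the left stays away from \<open>0\<close>, because \<open>s\<close> takes on \<open>B\<close> only values close to
  \<open>s(x)\<close>, whose distance to \<open>l s(x)\<close> is \<open>\<bar>l - 1\<bar>\<close>.
\<close>

lemma localized_modulus_vanishes:
  assumes f: "f \<in> Lp M p" "AE x in M. T f x = l * f x" "cmod l = 1" "l \<noteq> 1"
    and inv: "AE x in M. T (\<lambda>x. of_real (cmod (f x))) x = of_real (cmod (f x))"
    and B: "B \<in> sets M" "\<And>x. x \<in> B \<Longrightarrow> f x \<noteq> 0"
      "\<And>x. x \<in> B \<Longrightarrow> cmod (sgn (f x) - c) \<le> cmod (l - 1) / 16"
  shows "AE x in M. x \<in> B \<longrightarrow> T (\<lambda>x. indicator B x * of_real (cmod (f x))) x = 0"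
proof -
  let ?b = "\<lambda>x. indicator B x * complex_of_real (cmod (f x))"
  define d where "d = cmod (l - 1)"
  have d: "0 < d"
    using f(4) by (simp add: d_def)
  have u: "(\<lambda>x. complex_of_real (cmod (f x))) \<in> Lp M p"
    by (rule Lp_cmod[OF f(1)])
  have b: "?b \<in> Lp M p"
    by (rule Lp_dominated[OF p0 u]) (use B(1) Lp_measurable[OF u] in \<open>auto simp: indicator_def\<close>)
  obtain D :: "complex set" where D: "countable D" "\<forall>z. \<forall>e>0. \<exists>d\<in>D. cmod (d - z) < e"
    by (rule dense_complex)
  \<comment> \<open>The condition must not mention \<open>x\<close>: the exceptional null set has to be chosen before \<open>x\<close>.\<close>
  define far where "far v \<longleftrightarrow> (\<forall>y\<in>B. (d / 2)\<^sup>2 \<le> (cmod (sgn (f y) - v))\<^sup>2)" for v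
  have "AE x in M. far v \<longrightarrow> (d / 2)\<^sup>2 * Re (T ?b x) \<le> cmod (f x) * (cmod (l * sgn (f x) - v))\<^sup>2" for v
    using localized_modulus_le[OF f(1-3) inv B(1), of "(d / 2)\<^sup>2" v] unfolding far_def
    by (cases "far v") (auto simp: far_def)
  then have "AE x in M. \<forall>v\<in>D. far v \<longrightarrow> (d / 2)\<^sup>2 * Re (T ?b x) \<le> cmod (f x) * (cmod (l * sgn (f x) - v))\<^sup>2"
    by (simp add: AE_ball_countable D(1))
  moreover have "AE x in M. 0 \<le> T ?b x"
    by (intro nonneg b) (simp add: less_eq_complex_def indicator_def)
  ultimately show ?thesis
  proof eventually_elim
    case (elim x)
    show ?case
    proof
      assume x: "x \<in> B"
      define s where "s = sgn (f x)"
      have s: "cmod s = 1"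
        using B(2)[OF x] by (simp add: s_def norm_sgn)
      \<comment> \<open>Up to two radii \<open>d / 16\<close> of \<open>B\<close> and an error \<open>d / 8\<close> for \<open>v\<close>, the distance is \<open>d\<close>, which leaves more than \<open>d / 2\<close>.\<close>
      have far: "far v" if v: "cmod (v - l * s) < d / 8" for v
        unfolding far_def
      proof (intro ballI power_mono)
        fix y assume y: "y \<in> B"
        have "d = cmod (l * s - s)"
          using s by (simp add: d_def left_diff_distrib[of l 1 s, simplified, symmetric] norm_mult)
        also have "\<dots> = cmod (((sgn (f y) - c) - (s - c)) - ((sgn (f y) - v) + (v - l * s)))"
          by (simp add: algebra_simps)
        also have "\<dots> \<le> (cmod (sgn (f y) - c) + cmod (s - c)) + (cmod (sgn (f y) - v) + cmod (v - l * s))"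
          by (intro order.trans[OF norm_triangle_ineq4] add_mono norm_triangle_ineq4 norm_triangle_ineq)
        finally show "d / 2 \<le> cmod (sgn (f y) - v)"
          using v B(3)[OF x] B(3)[OF y] d unfolding s_def d_def by linarith
      qed (use d in simp)
      have "(d / 2)\<^sup>2 * Re (T ?b x) \<le> cmod (f x) * e\<^sup>2" if e: "0 < e" "e < d / 8" for e
      proof -
        obtain v where v: "v \<in> D" "cmod (v - l * s) < e"
          using D(2) e(1) by blast
        then have "(d / 2)\<^sup>2 * Re (T ?b x) \<le> cmod (f x) * (cmod (l * s - v))\<^sup>2"
          using elim(1) far[of v] e(2) by (simp add: s_def)
        also have "\<dots> \<le> cmod (f x) * e\<^sup>2"
          using v(2) by (intro mult_left_mono power_mono) (simp_all add: norm_minus_commute)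
        finally show ?thesis .
      qed
      then have "\<forall>\<^sub>F e in at_right 0. (d / 2)\<^sup>2 * Re (T ?b x) \<le> cmod (f x) * e\<^sup>2"
        using d by (intro eventually_at_rightI[of 0 "d / 8"]) auto
      moreover have "((\<lambda>e. cmod (f x) * e\<^sup>2) \<longlongrightarrow> cmod (f x) * 0\<^sup>2) (at_right 0)"
        by (intro tendsto_intros)
      ultimately have "(d / 2)\<^sup>2 * Re (T ?b x) \<le> cmod (f x) * 0\<^sup>2"
        by (intro tendsto_lowerbound) auto
      then have "Re (T ?b x) \<le> 0"
        using d by (simp add: mult_le_0_iff)
      with elim(2) show "T ?b x = 0"
        by (simp add: less_eq_complex_def complex_eq_iff)
    qed
  qed
qed

end

theorem theorem1p2:
  fixes M :: "'a measure" and p :: real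
    and T :: "('a \<Rightarrow> complex) \<Rightarrow> ('a \<Rightarrow> complex)"
    and S :: "'a set"
  assumes "sigma_finite_measure M"
    and "1 \<le> p"
    and "Lp_linear_operator M p T"
    and "Lp_positive_operator M p T"
    and "Lp_power_bounded M p T"
    and "Lp_irreducible M p T"
    and "S \<in> sets M" and "emeasure M S \<noteq> 0"
    and "\<And>f. f \<in> Lp M p \<Longrightarrow> Lp_nonneg M f \<Longrightarrow> AE_subset M (supp M f) S \<Longrightarrow>
           AE_subset M (supp M f) (supp M (T f))"
  shows "Lp_point_spectrum M p T \<inter> {z. cmod z = 1} \<subseteq> {1}"
proof (rule subsetI, rule ccontr)
  fix l assume "l \<in> Lp_point_spectrum M p T \<inter> {z. cmod z = 1}" and "l \<notin> {1}"
  then obtain f where f: "f \<in> Lp M p" "\<not> (AE x in M. f x = 0)" "AE x in M. T f x = l * f x"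
    and l: "cmod l = 1" "l \<noteq> 1"
    by (auto simp: Lp_point_spectrum_def Lp_eq_def)
  interpret positive_Lp_operator M p T
    by unfold_locales (fact assms)+
  have [measurable]: "f \<in> borel_measurable M" "S \<in> sets M"
    using f(1) assms(7) by (auto simp: Lp_def)
  let ?u = "\<lambda>x. complex_of_real (cmod (f x))"
  have u: "?u \<in> Lp M p" "AE x in M. 0 \<le> ?u x" "\<not> (AE x in M. ?u x = 0)"
    using f by (auto simp: Lp_cmod less_eq_complex_def)
  have inv: "AE x in M. T ?u x = ?u x"
    by (rule subinvariant_imp_invariant[OF assms(1,5,6) u eigen_modulus_le[OF f(1,3) l(1)]])
  have nz: "AE x in M. f x \<noteq> 0"
    using invariant_nonzero_AE[OF assms(1,6) u inv] by simp
  obtain D :: "complex set" where D: "countable D" "\<forall>z. \<forall>e>0. \<exists>d\<in>D. cmod (d - z) < e"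
    by (rule dense_complex)
  define d where "d = cmod (l - 1)"
  have d: "0 < d"
    using l(2) by (simp add: d_def)
  define B where "B c = {x \<in> S. f x \<noteq> 0 \<and> cmod (sgn (f x) - c) \<le> d / 16}" for c
  have "AE x in M. x \<notin> B c" for c
  proof -
    let ?b = "\<lambda>x. indicator (B c) x * ?u x"
    have "B c = S \<inter> {x \<in> space M. f x \<noteq> 0 \<and> cmod (f x /\<^sub>R cmod (f x) - c) \<le> d / 16}"
      using sets.sets_into_space[OF assms(7)] by (auto simp: B_def sgn_div_norm)
    then have Bm[measurable]: "B c \<in> sets M"
      by simp
    have b: "?b \<in> Lp M p"
      by (rule Lp_dominated[OF p0 u(1)]) (auto simp: indicator_def)
    have van: "AE x in M. x \<in> B c \<longrightarrow> T ?b x = 0"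
      by (rule localized_modulus_vanishes[OF f(1,3) l inv Bm, of c]) (auto simp: B_def d_def)
    have "AE_subset M (supp M ?b) (supp M (T ?b))"
    proof (rule assms(9)[OF b])
      show "Lp_nonneg M ?b"
        by (simp add: Lp_nonneg_def less_eq_complex_def indicator_def)
      show "AE_subset M (supp M ?b) S"
        by (auto simp: AE_subset_def supp_def B_def indicator_def)
    qed
    then have "AE x in M. x \<in> supp M ?b \<longrightarrow> x \<in> supp M (T ?b)"
      by (simp add: AE_subset_def)
    moreover have "AE x in M. x \<in> space M"
      by simp
    ultimately show ?thesis
      using van by eventually_elim (auto simp: supp_def B_def)
  qed
  then have "AE x in M. \<forall>c\<in>D. x \<notin> B c"
    by (simp add: AE_ball_countable D(1))
  with nz have "AE x in M. x \<notin> S"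
  proof eventually_elim
    case (elim x)
    obtain c where "c \<in> D" "cmod (c - sgn (f x)) < d / 16"
      using D(2) d by (meson divide_pos_pos zero_less_numeral)
    with elim show ?case
      by (force simp: B_def norm_minus_commute)
  qed
  with assms(7,8) show False
    by (simp add: AE_iff_null_sets[symmetric] null_sets_def)
qed

end
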